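(* Every local thrackle on $n$ vertices all of whose edges are straight-line segments has at most $n$ edges.
   Context: A topological graph is a (finite) graph drawn in the plane such that its vertices are represented by points and its edges by non-self-intersecting arcs connecting the corresponding points. No edge passes through a point representing a vertex other than its endpoints. Tangencies between edges are not allowed: if two edges share an interior point, they properly cross at this point. A topological graph is simple if every pair of its edges intersect at most once: at a common endpoint or at a proper crossing. A path of length $3$ consists of $4$ distinct vertices and $3$ edges; it is plane if no two of its edges cross. A local thrackle is a simple topological graph with no plane path of length $3$. *)

theory Defs
  imports "HOL-Analysis.Analysis"
begin

text \<open>
  A drawing of a graph with vertex set \<open>V\<close> and edge set \<open>E\<close> (a set of 2-element subsets of \<open>V\<close>)
  is given by the position \<open>pos v\<close> of each vertex and the point set \<open>dr e\<close> of the curve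
  representing each edge, endpoints included.
\<close>

type_synonym plane = "real ^ 2"

text \<open>
  \<open>A\<close> and \<open>B\<close> properly cross at \<open>p\<close>: some homeomorphism from a neighbourhood of \<open>p\<close> onto the open
  unit disc takes \<open>p\<close> to the centre, and \<open>A\<close> and \<open>B\<close> to the horizontal and the vertical diameter.
  This excludes tangencies, and also \<open>p\<close> being an endpoint of either curve.
\<close>

definition properly_cross_at :: "plane set \<Rightarrow> plane set \<Rightarrow> plane \<Rightarrow> bool" where
  "properly_cross_at A B p \<longleftrightarrow>
     (\<exists>U (h :: plane \<Rightarrow> plane) k. open U \<and> p \<in> U \<and> homeomorphism U (ball 0 1) h k \<and> h p = 0 \<and>
        h ` (A \<inter> U) = {x \<in> ball 0 1. x $ 2 = 0} \<and>
        h ` (B \<inter> U) = {x \<in> ball 0 1. x $ 1 = 0})"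

definition edge_interior :: "('v \<Rightarrow> plane) \<Rightarrow> ('v set \<Rightarrow> plane set) \<Rightarrow> 'v set \<Rightarrow> plane set" where
  "edge_interior pos dr e = dr e - pos ` e"

definition topological_graph ::
  "'v set \<Rightarrow> 'v set set \<Rightarrow> ('v \<Rightarrow> plane) \<Rightarrow> ('v set \<Rightarrow> plane set) \<Rightarrow> bool" where
  "topological_graph V E pos dr \<longleftrightarrow>
     finite V \<and> (\<forall>e\<in>E. e \<subseteq> V \<and> card e = 2) \<and>
     inj_on pos V \<and>
     (\<forall>e\<in>E. \<exists>g. arc g \<and> path_image g = dr e \<and> {pathstart g, pathfinish g} = pos ` e) \<and>
     (\<forall>e\<in>E. \<forall>v\<in>V. pos v \<in> dr e \<longrightarrow> v \<in> e) \<and>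
     (\<forall>e\<in>E. \<forall>f\<in>E. e \<noteq> f \<longrightarrow>
        (\<forall>p \<in> edge_interior pos dr e \<inter> edge_interior pos dr f.
           properly_cross_at (dr e) (dr f) p))"

definition edges_cross_at ::
  "('v \<Rightarrow> plane) \<Rightarrow> ('v set \<Rightarrow> plane set) \<Rightarrow> 'v set \<Rightarrow> 'v set \<Rightarrow> plane \<Rightarrow> bool" where
  "edges_cross_at pos dr e f p \<longleftrightarrow>
     p \<in> edge_interior pos dr e \<and> p \<in> edge_interior pos dr f \<and> properly_cross_at (dr e) (dr f) p"

definition simple_topological_graph ::
  "'v set \<Rightarrow> 'v set set \<Rightarrow> ('v \<Rightarrow> plane) \<Rightarrow> ('v set \<Rightarrow> plane set) \<Rightarrow> bool" where
  "simple_topological_graph V E pos dr \<longleftrightarrow>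
     topological_graph V E pos dr \<and>
     (\<forall>e\<in>E. \<forall>f\<in>E. e \<noteq> f \<longrightarrow>
        dr e \<inter> dr f = {} \<or>
        (\<exists>p. dr e \<inter> dr f = {p} \<and> (p \<in> pos ` (e \<inter> f) \<or> edges_cross_at pos dr e f p)))"

definition path_length_3 :: "'v set \<Rightarrow> 'v set set \<Rightarrow> 'v \<Rightarrow> 'v \<Rightarrow> 'v \<Rightarrow> 'v \<Rightarrow> bool" where
  "path_length_3 V E a b c d \<longleftrightarrow>
     {a, b, c, d} \<subseteq> V \<and> distinct [a, b, c, d] \<and> {a, b} \<in> E \<and> {b, c} \<in> E \<and> {c, d} \<in> E"

definition plane_edges :: "('v \<Rightarrow> plane) \<Rightarrow> ('v set \<Rightarrow> plane set) \<Rightarrow> 'v set set \<Rightarrow> bool" where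
  "plane_edges pos dr F \<longleftrightarrow>
     (\<forall>e\<in>F. \<forall>f\<in>F. e \<noteq> f \<longrightarrow> \<not> (\<exists>p. edges_cross_at pos dr e f p))"

definition local_thrackle ::
  "'v set \<Rightarrow> 'v set set \<Rightarrow> ('v \<Rightarrow> plane) \<Rightarrow> ('v set \<Rightarrow> plane set) \<Rightarrow> bool" where
  "local_thrackle V E pos dr \<longleftrightarrow>
     simple_topological_graph V E pos dr \<and>
     \<not> (\<exists>a b c d. path_length_3 V E a b c d \<and> plane_edges pos dr {{a, b}, {b, c}, {c, d}})"

definition straight_line_edges ::
  "'v set set \<Rightarrow> ('v \<Rightarrow> plane) \<Rightarrow> ('v set \<Rightarrow> plane set) \<Rightarrow> bool" where
  "straight_line_edges E pos dr \<longleftrightarrow>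
     (\<forall>u v. {u, v} \<in> E \<longrightarrow> dr {u, v} = closed_segment (pos u) (pos v))"

end

theory Submission
  imports Defs
begin

text \<open>
  The proof is a local form of Perles' counting argument for geometric thrackles: every edge is
  charged to one of its endpoints, and no vertex is charged twice.

  At a vertex \<open>u\<close>, an edge \<open>uw\<close> \<^emph>\<open>succeeds\<close> an edge \<open>uv\<close> if it is reached from \<open>uv\<close> by a
  counterclockwise turn through an angle in \<open>(0, \<pi>]\<close>.  Charge \<open>uv\<close> to \<open>u\<close> if nothing succeeds it
  there.  Two distinct edges at \<open>u\<close> never overlap, so one of them succeeds the other
  (\<open>half_turn_total\<close>), and \<open>u\<close> is charged at most once.

  If \<open>uv\<close> could be charged to neither endpoint, some \<open>uw\<close> would succeed it at \<open>u\<close> and some \<open>vx\<close>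
  would succeed it at \<open>v\<close>.  As counterclockwise turns at the two ends of a segment lead to opposite
  sides of its line, \<open>uw\<close> and \<open>vx\<close> are disjoint (\<open>half_turn_segments_disjoint\<close>), and \<open>w u v x\<close>
  is a plane path of length 3.

  Including the angle \<open>\<pi>\<close> settles ties: if \<open>uv\<close> and \<open>uw\<close> point in opposite directions, each of
  them succeeds the other.  Disjointness survives this, because then \<open>uw\<close> leaves the segment \<open>uv\<close>
  along its line.
\<close>

text \<open>
  The sign of the determinant of \<open>a\<close> and \<open>b\<close> tells on which side of \<open>a\<close> the vector \<open>b\<close> lies; when
  it vanishes, the inner product separates opposite directions from equal ones.
\<close>

definition det2 :: "plane \<Rightarrow> plane \<Rightarrow> real" where
  "det2 a b = a $ 1 * b $ 2 - a $ 2 * b $ 1"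

definition within_half_turn :: "plane \<Rightarrow> plane \<Rightarrow> bool" where
  "within_half_turn a b \<longleftrightarrow> det2 a b > 0 \<or> (det2 a b = 0 \<and> a \<bullet> b < 0)"

lemma det2_swap: "det2 b a = - det2 a b"
  by (simp add: det2_def)

lemma det2_uminus_left: "det2 (- a) b = - det2 a b"
  by (simp add: det2_def)

lemma det2_add_right: "det2 a (b + c) = det2 a b + det2 a c"
  by (simp add: det2_def algebra_simps)

lemma det2_scaleR_right: "det2 a (t *\<^sub>R b) = t * det2 a b"
  by (simp add: det2_def algebra_simps)

lemma det2_self: "det2 a a = 0"
  by (simp add: det2_def)

lemma not_within_half_turn_self: "\<not> within_half_turn a a"
  by (simp add: within_half_turn_def det2_self not_less)

lemma inner_plane: "(a :: plane) \<bullet> b = a $ 1 * b $ 1 + a $ 2 * b $ 2"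
  by (simp add: inner_vec_def sum_2)

text \<open>
  The vector \<open>a\<close> equals its projection on the line of \<open>b\<close>, and the Cauchy--Schwarz inequality
  bounds the coefficient by 1.
\<close>

lemma same_direction_shorter_in_segment:
  assumes det: "det2 a b = 0" and inner: "a \<bullet> b \<ge> 0" and le: "norm a \<le> norm b"
  shows "a \<in> closed_segment 0 b"
proof (cases "b = 0")
  case True
  then show ?thesis using le by simp
next
  case False
  define t where "t = (a \<bullet> b) / (b \<bullet> b)"
  have pos: "b \<bullet> b > 0" using False by simp
  have "a \<bullet> b \<le> norm a * norm b" by (rule norm_cauchy_schwarz)
  also have "\<dots> \<le> norm b * norm b" using le by (simp add: mult_right_mono)
  also have "\<dots> = b \<bullet> b" by (simp add: dot_square_norm power2_eq_square)
  finally have t: "0 \<le> t" "t \<le> 1" using inner pos by (auto simp: t_def)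
  have "(b \<bullet> b) * a $ i = (a \<bullet> b) * b $ i" for i
  proof -
    have "(b \<bullet> b) * a $ 1 - (a \<bullet> b) * b $ 1 = det2 a b * b $ 2"
      "(b \<bullet> b) * a $ 2 - (a \<bullet> b) * b $ 2 = - det2 a b * b $ 1"
      by (simp_all add: inner_plane det2_def algebra_simps)
    then show ?thesis using det exhaust_2[of i] by auto
  qed
  then have "a = t *\<^sub>R b"
    using pos by (simp add: vec_eq_iff t_def field_simps)
  then show ?thesis using t by (auto simp: in_segment)
qed

lemma half_turn_total:
  assumes "\<not> within_half_turn a b" "\<not> within_half_turn b a"
  shows "a \<in> closed_segment 0 b \<or> b \<in> closed_segment 0 a"
proof -
  have "det2 a b = 0" "det2 b a = 0" "a \<bullet> b \<ge> 0"
    using assms det2_swap[of a b] by (auto simp: within_half_turn_def)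
  then show ?thesis
    using same_direction_shorter_in_segment[of a b] same_direction_shorter_in_segment[of b a]
    by (metis inner_commute linear)
qed

text \<open>
  The line through \<open>p\<close> and \<open>q\<close> weakly separates the two segments, and a segment meeting the line
  outside its endpoint \<open>p\<close> or \<open>q\<close> runs along the line away from the other one.  Hence on the line the
  first segment stays behind \<open>p\<close> and the second beyond \<open>q\<close>.
\<close>

lemma half_turn_segments_disjoint:
  assumes ne: "p \<noteq> q"
    and left: "within_half_turn (q - p) (r - p)"
    and right: "within_half_turn (p - q) (s - q)"
  shows "closed_segment p r \<inter> closed_segment q s = {}"
proof (rule ccontr)
  define d where "d = q - p"
  assume "closed_segment p r \<inter> closed_segment q s \<noteq> {}"
  then obtain z where "z \<in> closed_segment p r" "z \<in> closed_segment q s" by auto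
  then obtain x y where x: "0 \<le> x" "z = (1 - x) *\<^sub>R p + x *\<^sub>R r"
    and y: "0 \<le> y" "z = (1 - y) *\<^sub>R q + y *\<^sub>R s"
    by (auto simp: in_segment)
  have r: "det2 d (r - p) \<ge> 0" "det2 d (r - p) = 0 \<Longrightarrow> d \<bullet> (r - p) < 0"
    using left by (auto simp: within_half_turn_def d_def)
  have "p - q = - d" by (simp add: d_def)
  then have s: "det2 d (s - q) \<le> 0" "det2 d (s - q) = 0 \<Longrightarrow> d \<bullet> (s - q) > 0"
    using right by (auto simp: within_half_turn_def det2_uminus_left)
  have eq: "x *\<^sub>R (r - p) = d + y *\<^sub>R (s - q)"
    using x(2) y(2) by (simp add: d_def algebra_simps)
  have "x * det2 d (r - p) = y * det2 d (s - q)"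
    using arg_cong[OF eq, of "det2 d"] by (simp add: det2_add_right det2_scaleR_right det2_self)
  moreover have "x * det2 d (r - p) \<ge> 0" using x r by simp
  moreover have "y * det2 d (s - q) \<le> 0" using y s by (simp add: mult_nonneg_nonpos)
  ultimately have "x = 0 \<or> det2 d (r - p) = 0" "y = 0 \<or> det2 d (s - q) = 0"
    by auto
  then have "x * (d \<bullet> (r - p)) \<le> 0" "y * (d \<bullet> (s - q)) \<ge> 0"
    using x r y s by (auto simp: mult_nonneg_nonpos)
  moreover have "x * (d \<bullet> (r - p)) = d \<bullet> d + y * (d \<bullet> (s - q))"
    using arg_cong[OF eq, of "\<lambda>v. d \<bullet> v"] by (simp add: inner_add_right)
  moreover have "d \<bullet> d > 0" using ne by (simp add: d_def)
  ultimately show False by linarith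
qed

definition succeeded_at :: "'v set set \<Rightarrow> ('v \<Rightarrow> plane) \<Rightarrow> 'v \<Rightarrow> 'v \<Rightarrow> bool" where
  "succeeded_at E pos u v \<longleftrightarrow>
     (\<exists>w. {u, w} \<in> E \<and> within_half_turn (pos v - pos u) (pos w - pos u))"

text \<open>The single common point allowed in a simple drawing is already used up by the shared vertex.\<close>

lemma adjacent_edges_not_crossing:
  assumes simp_graph: "simple_topological_graph V E pos dr"
    and straight: "straight_line_edges E pos dr"
    and edges: "{u, v} \<in> E" "{u, w} \<in> E" and ne: "{u, v} \<noteq> {u, w}"
  shows "\<not> edges_cross_at pos dr {u, v} {u, w} p"
proof
  assume "edges_cross_at pos dr {u, v} {u, w} p"
  then have p: "p \<in> dr {u, v} \<inter> dr {u, w}" "p \<noteq> pos u"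
    by (auto simp: edges_cross_at_def edge_interior_def)
  have "pos u \<in> dr {u, v} \<inter> dr {u, w}"
    using straight edges by (auto simp: straight_line_edges_def)
  moreover have "dr {u, v} \<inter> dr {u, w} = {} \<or> (\<exists>q. dr {u, v} \<inter> dr {u, w} = {q})"
    using simp_graph edges ne unfolding simple_topological_graph_def by metis
  ultimately show False using p by (metis empty_iff singletonD)
qed

lemma unsucceeded_unique:
  assumes graph: "topological_graph V E pos dr"
    and straight: "straight_line_edges E pos dr"
    and edges: "{u, v} \<in> E" "{u, w} \<in> E"
    and "\<not> succeeded_at E pos u v" "\<not> succeeded_at E pos u w"
  shows "v = w"
proof -
  have V: "v \<in> V" "w \<in> V" "u \<noteq> v" "u \<noteq> w"
    using graph edges by (auto simp: topological_graph_def)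
  have "\<not> within_half_turn (pos v - pos u) (pos w - pos u)"
    "\<not> within_half_turn (pos w - pos u) (pos v - pos u)"
    using assms by (auto simp: succeeded_at_def)
  then have "pos v - pos u \<in> closed_segment 0 (pos w - pos u) \<or>
      pos w - pos u \<in> closed_segment 0 (pos v - pos u)"
    by (rule half_turn_total)
  then have "pos v \<in> closed_segment (pos u) (pos w) \<or> pos w \<in> closed_segment (pos u) (pos v)"
    using closed_segment_translation_eq[of "- pos u" "pos v" "pos u" "pos w"]
      closed_segment_translation_eq[of "- pos u" "pos w" "pos u" "pos v"] by simp
  then have "pos v \<in> dr {u, w} \<or> pos w \<in> dr {u, v}"
    using straight edges by (auto simp: straight_line_edges_def)
  \<comment> \<open>overlapping edges would put a vertex on an edge of which it is not an endpoint\<close>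
  then have "v \<in> {u, w} \<or> w \<in> {u, v}"
    using graph edges V unfolding topological_graph_def by blast
  then show ?thesis using V by auto
qed

lemma edge_unsucceeded_at_an_end:
  assumes thrackle: "local_thrackle V E pos dr"
    and straight: "straight_line_edges E pos dr"
    and uv: "{u, v} \<in> E"
  shows "\<not> succeeded_at E pos u v \<or> \<not> succeeded_at E pos v u"
proof (rule ccontr)
  assume "\<not> ?thesis"
  then obtain w x where w: "{u, w} \<in> E" "within_half_turn (pos v - pos u) (pos w - pos u)"
    and x: "{v, x} \<in> E" "within_half_turn (pos u - pos v) (pos x - pos v)"
    by (auto simp: succeeded_at_def)
  have simp_graph: "simple_topological_graph V E pos dr"
    using thrackle by (simp add: local_thrackle_def)
  then have graph: "topological_graph V E pos dr"
    by (simp add: simple_topological_graph_def)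
  have ends: "u \<noteq> v" "u \<noteq> w" "v \<noteq> x" "u \<in> V" "v \<in> V" "w \<in> V" "x \<in> V"
    using graph uv w x by (auto simp: topological_graph_def)
  then have "pos u \<noteq> pos v"
    using graph by (auto simp: topological_graph_def inj_on_def)
  then have disj: "closed_segment (pos u) (pos w) \<inter> closed_segment (pos v) (pos x) = {}"
    using half_turn_segments_disjoint w x by blast
  have "w \<noteq> v" "x \<noteq> u" using w x not_within_half_turn_self by auto
  \<comment> \<open>disjointness also rules out that the edges close up to a triangle\<close>
  moreover have "w \<noteq> x" using disj by auto
  ultimately have path: "path_length_3 V E w u v x"
    using ends uv w x by (auto simp: path_length_3_def insert_commute)
  have "\<not> edges_cross_at pos dr {w, u} {v, x} p" "\<not> edges_cross_at pos dr {v, x} {w, u} p" for p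
    using disj straight w x
    by (auto simp: edges_cross_at_def edge_interior_def straight_line_edges_def insert_commute)
  moreover have "\<not> edges_cross_at pos dr {w, u} {u, v} p" "\<not> edges_cross_at pos dr {u, v} {w, u} p"
      if "{w, u} \<noteq> {u, v}" for p
    using adjacent_edges_not_crossing[OF simp_graph straight, of u w v p]
      adjacent_edges_not_crossing[OF simp_graph straight, of u v w p] uv w that
    by (auto simp: insert_commute)
  moreover have "\<not> edges_cross_at pos dr {v, x} {u, v} p" "\<not> edges_cross_at pos dr {u, v} {v, x} p"
      if "{v, x} \<noteq> {u, v}" for p
    using adjacent_edges_not_crossing[OF simp_graph straight, of v x u p]
      adjacent_edges_not_crossing[OF simp_graph straight, of v u x p] uv x that
    by (auto simp: insert_commute)
  ultimately have "plane_edges pos dr {{w, u}, {u, v}, {v, x}}"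
    unfolding plane_edges_def by (metis insert_iff singletonD)
  then show False using path thrackle by (auto simp: local_thrackle_def)
qed

theorem proposition1p5:
  fixes V :: "'v set" and E :: "'v set set"
    and pos :: "'v \<Rightarrow> plane" and dr :: "'v set \<Rightarrow> plane set" and n :: nat
  assumes "local_thrackle V E pos dr"
    and "card V = n"
    and "straight_line_edges E pos dr"
  shows "card E \<le> n"
proof -
  have graph: "topological_graph V E pos dr"
    using assms(1) by (simp add: local_thrackle_def simple_topological_graph_def)
  then have finV: "finite V" and edge: "\<And>e. e \<in> E \<Longrightarrow> e \<subseteq> V \<and> card e = 2"
    by (auto simp: topological_graph_def)
  have "\<exists>u v. e = {u, v} \<and> \<not> succeeded_at E pos u v" if "e \<in> E" for e :: "'v set"
  proof -
    obtain u v where "e = {u, v}" using edge \<open>e \<in> E\<close> by (meson card_2_iff)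
    then show ?thesis
      using edge_unsucceeded_at_an_end[OF assms(1,3)] that by (metis insert_commute)
  qed
  then obtain owner other where
    charge: "\<And>e. e \<in> E \<Longrightarrow> e = {owner e, other e} \<and> \<not> succeeded_at E pos (owner e) (other e)"
    by metis
  have "inj_on owner E"
    using unsucceeded_unique[OF graph assms(3)] charge by (intro inj_onI) metis
  moreover have "owner ` E \<subseteq> V" using edge charge by blast
  ultimately have "card E \<le> card V" using finV by (rule card_inj_on_le)
  then show ?thesis using assms(2) by simp
qed

end
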